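(* Let $k\ge 5$ be an integer. Then \[\gamma^{SID}(C_{2k}(1,k))=\begin{cases}\left\lceil\frac{4k}{3}\right\rceil & \text{if } k\equiv 0,1\pmod 3,\\ \left\lceil\frac{4k}{3}\right\rceil+1 & \text{if } k\equiv 2\pmod 3.\end{cases}\]
   Context: All graphs are simple and undirected. For a graph $G=(V,E)$ and $u\in V$, $N[u]=\{u\}\cup\{v: uv\in E\}$. A code is a nonempty $C\subseteq V$, and $I(C;u)=N[u]\cap C$. $C$ is self-identifying if $I(C;u)\setminus I(C;v)\neq\emptyset$ for all distinct $u,v\in V$. $\gamma^{SID}(G)$ is the minimum cardinality of a self-identifying code in a finite graph $G$. The circulant graph $C_{2k}(1,k)$ has vertex set $\mathbb{Z}_{2k}$, and the open neighbourhood of $u$ is $\{u-1,u+1,u+k\}$ modulo $2k$ (note $u-k\equiv u+k$). *)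

theory Defs
  imports Complex_Main "Graph_Theory.Pair_Digraph"
begin

text \<open>
  A finite simple undirected graph is an instance of the locale \<open>pair_graph\<close>: an edge \<open>uv\<close> is
  represented by the two arcs \<open>(u, v)\<close> and \<open>(v, u)\<close>.
\<close>

definition closed_nbhd :: "'a pair_pre_digraph \<Rightarrow> 'a \<Rightarrow> 'a set" where
  "closed_nbhd G u = {u} \<union> {v. (u, v) \<in> parcs G}"

definition is_code :: "'a pair_pre_digraph \<Rightarrow> 'a set \<Rightarrow> bool" where
  "is_code G C \<longleftrightarrow> C \<noteq> {} \<and> C \<subseteq> pverts G"

definition I_set :: "'a pair_pre_digraph \<Rightarrow> 'a set \<Rightarrow> 'a \<Rightarrow> 'a set" where
  "I_set G C u = closed_nbhd G u \<inter> C"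

definition self_identifying :: "'a pair_pre_digraph \<Rightarrow> 'a set \<Rightarrow> bool" where
  "self_identifying G C \<longleftrightarrow> is_code G C \<and>
     (\<forall>u\<in>pverts G. \<forall>v\<in>pverts G. u \<noteq> v \<longrightarrow> I_set G C u - I_set G C v \<noteq> {})"

text \<open>
  The value is meaningful only for finite graphs that admit a self-identifying code; otherwise it
  is the minimum of an empty set (unspecified), or involves cardinalities of infinite sets.
\<close>

definition gamma_SID :: "'a pair_pre_digraph \<Rightarrow> nat" where
  "gamma_SID G = Min {card C | C. self_identifying G C}"

text \<open>\<open>circulant_1k k\<close> is \<open>C\<^bsub>2k\<^esub>(1,k)\<close>, with \<open>\<int>\<^bsub>2k\<^esub>\<close> represented by the residues \<open>0, \<dots>, 2k - 1\<close>.\<close>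

definition circulant_1k :: "nat \<Rightarrow> int pair_pre_digraph" where
  "circulant_1k k =
    \<lparr> pverts = {0..<2 * int k},
      parcs = {(u, v). u \<in> {0..<2 * int k} \<and>
        v \<in> {(u - 1) mod (2 * int k), (u + 1) mod (2 * int k), (u + int k) mod (2 * int k)}} \<rparr>"

lemma pair_graph_circulant_1k:
  assumes "k \<ge> 1"
  shows "pair_graph (circulant_1k k)"
proof -
  define n where "n = 2 * int k"
  define V where "V = {0..<n}"
  have n: "n \<ge> 2" using assms by (simp add: n_def)
  have G: "pverts (circulant_1k k) = V"
    "\<And>u v. (u, v) \<in> parcs (circulant_1k k) \<longleftrightarrow>
       u \<in> V \<and> v \<in> {(u - 1) mod n, (u + 1) mod n, (u + int k) mod n}"
    by (auto simp: circulant_1k_def V_def n_def)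
  have wf: "u \<in> V \<and> v \<in> V" if "(u, v) \<in> parcs (circulant_1k k)" for u v
    using that n unfolding G by (auto simp: V_def)
  have rep: "u mod n = u" if "u \<in> V" for u
    using that by (simp add: V_def)
  have loop: "u \<noteq> v" if "(u, v) \<in> parcs (circulant_1k k)" for u v
  proof
    assume "u = v"
    then have "u mod n = (u - 1) mod n \<or> u mod n = (u + 1) mod n \<or> u mod n = (u + int k) mod n"
      using that rep[of u] unfolding G by auto
    then have "n dvd 1 \<or> n dvd int k"
      by (auto simp: mod_eq_dvd_iff dvd_minus_iff)
    moreover have "\<not> n dvd 1" using n by (auto dest: zdvd_imp_le)
    moreover have "\<not> n dvd int k" using n by (auto simp: n_def dest: zdvd_imp_le)
    ultimately show False by blast
  qed
  have symm: "(v, u) \<in> parcs (circulant_1k k)" if uv: "(u, v) \<in> parcs (circulant_1k k)" for u v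
  proof -
    have u: "u \<in> V" and v: "v \<in> V" using wf[OF uv] by auto
    consider "v = (u - 1) mod n" | "v = (u + 1) mod n" | "v = (u + int k) mod n"
      using uv unfolding G by auto
    then have "u \<in> {(v - 1) mod n, (v + 1) mod n, (v + int k) mod n}"
    proof cases
      case 1
      then have "(v + 1) mod n = u mod n" by (simp add: mod_simps)
      then show ?thesis using rep[OF u] by auto
    next
      case 2
      then have "(v - 1) mod n = u mod n" by (simp add: mod_simps)
      then show ?thesis using rep[OF u] by auto
    next
      case 3
      then have "(v + int k) mod n = (u + n) mod n"
        by (simp add: mod_simps n_def add.assoc)
      then show ?thesis using rep[OF u] by auto
    qed
    with v show ?thesis unfolding G by blast
  qed
  have "finite V" by (simp add: V_def)
  moreover have "parcs (circulant_1k k) \<subseteq> V \<times> V" using wf by auto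
  ultimately have fin: "finite (parcs (circulant_1k k))"
    by (meson finite_SigmaI finite_subset)
  have "sym (parcs (circulant_1k k))" using symm by (auto intro: symI)
  then have "symmetric (with_proj (circulant_1k k))"
    by (simp add: symmetric_def arcs_ends_def arc_to_ends_def)
  moreover have "fst e \<in> V" "snd e \<in> V" "fst e \<noteq> snd e" if "e \<in> parcs (circulant_1k k)" for e
    using that wf[of "fst e" "snd e"] loop[of "fst e" "snd e"] by auto
  ultimately show ?thesis
    using fin \<open>finite V\<close> by unfold_locales (simp_all add: G(1))
qed

end

theory Submission
  imports Defs
begin

text \<open>
  The inclusion-minimal sets \<open>N[u] - N[v]\<close> with \<open>u \<noteq> v\<close> are the pairs of vertices that differ by
  \<open>1\<close>, \<open>2\<close> or \<open>k + 1\<close>, so a code is self-identifying iff its complement \<open>D\<close> contains no such pair,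
  and the task is to maximise \<open>|D|\<close>. Let \<open>w i\<close> be the number of elements of \<open>D\<close> among the antipodal
  vertices \<open>i\<close> and \<open>i + k\<close>. Then \<open>w\<close> has period \<open>k\<close>, the sum of \<open>w\<close> over a period is \<open>|D|\<close>, one of
  \<open>w i\<close> and \<open>w (i + 1)\<close> is \<open>0\<close>, and \<open>w i + w (i + 2) \<le> 2\<close>. If \<open>w\<close> has two consecutive zeros, cut the
  cycle there and divide it into blocks of length \<open>3\<close>, each of sum at most \<open>2\<close>. Otherwise the zeros
  alternate with values that must all be \<open>1\<close>. In either case \<open>|D| \<le> 2 \<lfloor>k/3\<rfloor>\<close>, and the vertices
  congruent to \<open>0, 3, \<dots>, 3 \<lfloor>k/3\<rfloor> - 3\<close> modulo \<open>k\<close> attain this bound.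
\<close>

subsection \<open>Sums over a period\<close>

lemma sum_atLeastLessThan_le_of_blocks:
  fixes f :: "nat \<Rightarrow> 'a::{semiring_1, ordered_comm_monoid_add}"
  assumes "\<And>i. sum f {i..<i + l} \<le> c"
  shows "sum f {a..<a + q * l} \<le> of_nat q * c"
proof (induction q)
  case (Suc q)
  have "sum f {a..<a + Suc q * l} = sum f {a..<a + q * l} + sum f {a + q * l..<a + q * l + l}"
    by (simp add: sum.atLeastLessThan_concat ac_simps)
  also have "\<dots> \<le> of_nat q * c + c" by (intro add_mono Suc assms)
  also have "\<dots> = of_nat (Suc q) * c" by (simp add: distrib_right add.commute)
  finally show ?case .
qed simp

lemma sum_period_shift:
  fixes f :: "nat \<Rightarrow> 'a::comm_monoid_add"
  assumes "\<And>i. f (i + n) = f i"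
  shows "sum f {a..<a + n} = sum f {..<n}"
proof (induction a)
  case 0
  show ?case by (simp add: lessThan_atLeast0)
next
  case (Suc a)
  show ?case
  proof (cases "n = 0")
    case False
    then have "sum f {Suc a..<Suc a + n} = sum f {Suc a..<a + n} + f (a + n)" by simp
    also have "\<dots> = f a + sum f {Suc a..<a + n}" using assms by (simp add: add.commute)
    also have "\<dots> = sum f {a..<a + n}" using False by (simp add: sum.atLeast_Suc_lessThan)
    finally show ?thesis using Suc by simp
  qed simp
qed

lemma sum_period_le_of_blocks:
  fixes f :: "nat \<Rightarrow> 'a::{semiring_1, ordered_comm_monoid_add}"
  assumes period: "\<And>i. f (i + n) = f i"
    and gap: "\<And>i. i \<in> {a..<a + r} \<Longrightarrow> f i = 0"
    and mod_le: "n mod l \<le> r"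
    and block: "\<And>i. sum f {i..<i + l} \<le> c"
  shows "sum f {..<n} \<le> of_nat (n div l) * c"
proof -
  define b where "b = a + r"
  have n_split: "n = n div l * l + n mod l" by simp
  have zero_rest: "f i = 0" if "i \<in> {b + n div l * l..<b + n}" for i
  proof -
    have bounds: "a + r + n div l * l \<le> i" "i < a + r + n"
      using that by (simp_all add: b_def)
    have "n \<le> i" using bounds mod_le n_split by linarith
    moreover have "i - n \<in> {a..<a + r}"
      using bounds mod_le n_split unfolding atLeastLessThan_iff by linarith
    ultimately show ?thesis using gap period by (metis le_add_diff_inverse2)
  qed
  have "sum f {..<n} = sum f {b..<b + n}" using period by (rule sum_period_shift[symmetric])
  also have "\<dots> = sum f {b..<b + n div l * l} + sum f {b + n div l * l..<b + n}"
    by (rule sum.atLeastLessThan_concat[symmetric]) auto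
  also have "\<dots> = sum f {b..<b + n div l * l}" using zero_rest by simp
  also have "\<dots> \<le> of_nat (n div l) * c" using block by (rule sum_atLeastLessThan_le_of_blocks)
  finally show ?thesis .
qed

lemma sum_period_le_two_thirds:
  fixes w :: "nat \<Rightarrow> nat"
  assumes n_ge: "n \<ge> 3"
    and period: "\<And>i. w (i + n) = w i"
    and adjacent: "\<And>i. w i = 0 \<or> w (i + 1) = 0"
    and next_but_one: "\<And>i. w i + w (i + 2) \<le> 2"
  shows "sum w {..<n} \<le> 2 * (n div 3)"
proof (cases "\<exists>a. w a = 0 \<and> w (a + 1) = 0")
  case True
  then obtain a where "w a = 0" "w (a + 1) = 0" by blast
  then have "w i = 0" if "i \<in> {a..<a + 2}" for i
    using that by (cases "i = a") (auto simp: less_Suc_eq)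
  moreover have "sum w {i..<i + 3} \<le> 2" for i
    using adjacent[of i] adjacent[of "i + 1"] next_but_one[of i] next_but_one[of "i + 1"]
    by (auto simp: numeral_3_eq_3)
  moreover have "n mod 3 \<le> 2" by simp
  ultimately have "sum w {..<n} \<le> of_nat (n div 3) * 2"
    using period by (intro sum_period_le_of_blocks)
  then show ?thesis by simp
next
  case False
  then have "w i \<noteq> 0 \<or> w (i + 1) \<noteq> 0" for i by simp
  then have alternate: "w i = 0 \<longleftrightarrow> w (i + 1) \<noteq> 0" for i
    using adjacent[of i] by metis
  have le_one: "w i \<le> 1" for i
    using alternate[of i] alternate[of "i + 1"] next_but_one[of i] by auto
  obtain a where "w a = 0" using adjacent[of 0] by blast
  then have "w i = 0" if "i \<in> {a..<a + 1}" for i using that by simp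
  moreover have "sum w {i..<i + 2} \<le> 1" for i
    using adjacent[of i] le_one[of i] le_one[of "i + 1"] by (auto simp: numeral_2_eq_2)
  moreover have "n mod 2 \<le> 1" by simp
  ultimately have "sum w {..<n} \<le> of_nat (n div 2) * 1"
    using period by (intro sum_period_le_of_blocks)
  also have "\<dots> \<le> 2 * (n div 3)" using n_ge by simp
  finally show ?thesis .
qed

subsection \<open>Self-identifying codes of the circulant graph\<close>

lemma dvd_iff_eq_0_or_eq:
  fixes n z :: int
  assumes "- n < z" "z < 2 * n"
  shows "n dvd z \<longleftrightarrow> z = 0 \<or> z = n"
proof
  assume "n dvd z"
  then obtain q where z_eq: "z = n * q" by (elim dvdE)
  have "n > 0" using assms by linarith
  then have "- 1 < q" "q < 2"
    using assms mult_less_cancel_left_pos[of n "- 1" q] mult_less_cancel_left_pos[of n q 2]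
    by (simp_all add: z_eq mult.commute)
  then have "q = 0 \<or> q = 1" by linarith
  then show "z = 0 \<or> z = n" using z_eq by auto
qed auto

lemma gamma_SID_eqI:
  assumes "finite (pverts G)" "self_identifying G C"
    and "\<And>C'. self_identifying G C' \<Longrightarrow> card C \<le> card C'"
  shows "gamma_SID G = card C"
proof -
  have "{C. self_identifying G C} \<subseteq> Pow (pverts G)"
    by (auto simp: self_identifying_def is_code_def)
  then have "finite {C. self_identifying G C}" using assms(1) by (simp add: finite_subset)
  then show ?thesis unfolding gamma_SID_def using assms(2,3) by (intro Min_eqI) auto
qed

lemma pverts_circulant_1k: "pverts (circulant_1k k) = {0..<2 * int k}"
  by (simp add: circulant_1k_def)

abbreviation circulant_nbhd :: "nat \<Rightarrow> int \<Rightarrow> int set" where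
  "circulant_nbhd k u \<equiv> closed_nbhd (circulant_1k k) (u mod (2 * int k))"

lemma circulant_nbhd_eq:
  assumes "k \<ge> 1"
  shows "circulant_nbhd k u = (\<lambda>e. (u + e) mod (2 * int k)) ` {- 1, 0, 1, int k}"
  using assms by (auto simp: closed_nbhd_def circulant_1k_def mod_simps)

lemma mem_circulant_nbhd_iff:
  fixes k :: nat and d u :: int
  defines "n \<equiv> 2 * int k"
  assumes k_pos: "k \<ge> 1" and d_bounds: "0 < d" "d < n"
  shows "u mod n \<in> circulant_nbhd k (u + d) \<longleftrightarrow> d \<in> {1, int k, n - 1}"
    and "(u + 1) mod n \<in> circulant_nbhd k (u + d) \<longleftrightarrow> d \<in> {1, 2, int k + 1}"
    and "(u - 1) mod n \<in> circulant_nbhd k (u + d) \<longleftrightarrow> d \<in> {int k - 1, n - 2, n - 1}"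
    and "(u + int k) mod n \<in> circulant_nbhd k (u + d) \<longleftrightarrow>
      d \<in> {int k - 1, int k, int k + 1}"
proof -
  have mem_iff: "(u + e) mod n \<in> circulant_nbhd k (u + d) \<longleftrightarrow>
      (\<exists>f\<in>{- 1, 0, 1, int k}. d + f = e \<or> d + f = e + n)"
    if e_bounds: "- 1 \<le> e" "e \<le> int k" for e
  proof -
    have "(u + e) mod n = (u + d + f) mod n \<longleftrightarrow> d + f = e \<or> d + f = e + n"
      if f_mem: "f \<in> {- 1, 0, 1, int k}" for f
    proof -
      have "(u + e) mod n = (u + d + f) mod n \<longleftrightarrow> n dvd d + f - e"
        using mod_eq_dvd_iff[of "u + d + f" n "u + e"] by (auto simp: algebra_simps)
      also have "\<dots> \<longleftrightarrow> d + f - e = 0 \<or> d + f - e = n"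
        using d_bounds e_bounds f_mem k_pos by (intro dvd_iff_eq_0_or_eq) (auto simp: n_def)
      finally show ?thesis by auto
    qed
    then show ?thesis
      unfolding n_def circulant_nbhd_eq[OF k_pos] image_iff by (intro bex_cong) auto
  qed
  show "u mod n \<in> circulant_nbhd k (u + d) \<longleftrightarrow> d \<in> {1, int k, n - 1}"
    using mem_iff[of 0] d_bounds k_pos by (auto simp: n_def)
  show "(u + 1) mod n \<in> circulant_nbhd k (u + d) \<longleftrightarrow> d \<in> {1, 2, int k + 1}"
    using mem_iff[of 1] d_bounds k_pos by (auto simp: n_def)
  show "(u - 1) mod n \<in> circulant_nbhd k (u + d) \<longleftrightarrow>
      d \<in> {int k - 1, n - 2, n - 1}"
    using mem_iff[of "- 1"] d_bounds k_pos by (auto simp: n_def)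
  show "(u + int k) mod n \<in> circulant_nbhd k (u + d) \<longleftrightarrow>
      d \<in> {int k - 1, int k, int k + 1}"
    using mem_iff[of "int k"] d_bounds k_pos by (auto simp: n_def)
qed

definition conflict_pairs :: "nat \<Rightarrow> int set set" where
  "conflict_pairs k =
    {{x mod (2 * int k), (x + d) mod (2 * int k)} | x d. d \<in> {1, 2, int k + 1}}"

definition conflict_free :: "nat \<Rightarrow> int set \<Rightarrow> bool" where
  "conflict_free k D \<longleftrightarrow> (\<forall>P\<in>conflict_pairs k. \<not> P \<subseteq> D)"

lemma conflict_freeD:
  assumes "conflict_free k D" "x mod (2 * int k) \<in> D" "d \<in> {1, 2, int k + 1}"
  shows "(x + d) mod (2 * int k) \<notin> D"
proof -
  have "{x mod (2 * int k), (x + d) mod (2 * int k)} \<in> conflict_pairs k"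
    using assms(3) unfolding conflict_pairs_def by blast
  with assms(1) have "\<not> {x mod (2 * int k), (x + d) mod (2 * int k)} \<subseteq> D"
    unfolding conflict_free_def by (rule bspec)
  then show ?thesis using assms(2) by simp
qed

lemma circulant_nbhd_diff_subset_conflict_pair:
  fixes k :: nat and d u :: int
  defines "n \<equiv> 2 * int k"
  assumes k_ge: "k \<ge> 2" and d_mem: "d \<in> {1, 2, int k + 1}"
  shows "circulant_nbhd k u - circulant_nbhd k (u + (int k + 2 - d)) \<subseteq>
    {(u - 1) mod n, (u - 1 + d) mod n}"
proof -
  let ?N_v = "circulant_nbhd k (u + (int k + 2 - d))"
  have N_u: "circulant_nbhd k u = {(u - 1) mod n, u mod n, (u + 1) mod n, (u + int k) mod n}"
    using circulant_nbhd_eq[of k u] k_ge by (simp add: n_def)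
  have "0 < int k + 2 - d" "int k + 2 - d < n" using d_mem k_ge by (auto simp: n_def)
  then have mem_N_v: "u mod n \<in> ?N_v \<longleftrightarrow> int k + 2 - d \<in> {1, int k, n - 1}"
    "(u + 1) mod n \<in> ?N_v \<longleftrightarrow> int k + 2 - d \<in> {1, 2, int k + 1}"
    "(u + int k) mod n \<in> ?N_v \<longleftrightarrow> int k + 2 - d \<in> {int k - 1, int k, int k + 1}"
    using mem_circulant_nbhd_iff[of k "int k + 2 - d" u] k_ge by (simp_all only: n_def)
  consider (one) "d = 1" | (two) "d = 2" | (antipode_succ) "d = int k + 1"
    using d_mem by auto
  then show ?thesis
  proof cases
    case one
    then have "(u + 1) mod n \<in> ?N_v" "(u + int k) mod n \<in> ?N_v" unfolding mem_N_v by simp_all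
    then show ?thesis unfolding N_u using one by auto
  next
    case two
    then have "u mod n \<in> ?N_v" "(u + int k) mod n \<in> ?N_v" unfolding mem_N_v by simp_all
    then show ?thesis unfolding N_u using two by (auto simp: add.commute)
  next
    case antipode_succ
    then have "u mod n \<in> ?N_v" "(u + 1) mod n \<in> ?N_v" unfolding mem_N_v by simp_all
    then show ?thesis unfolding N_u using antipode_succ by auto
  qed
qed

lemma conflict_pair_contains_closed_nbhd_diff:
  assumes k_ge: "k \<ge> 2" and pair: "P \<in> conflict_pairs k"
  obtains u v where "u \<in> pverts (circulant_1k k)" "v \<in> pverts (circulant_1k k)" "u \<noteq> v"
    "closed_nbhd (circulant_1k k) u - closed_nbhd (circulant_1k k) v \<subseteq> P"
proof -
  define n where "n = 2 * int k"
  obtain x d where d_mem: "d \<in> {1, 2, int k + 1}" and P_eq: "P = {x mod n, (x + d) mod n}"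
    using pair by (auto simp: conflict_pairs_def n_def)
  let ?u = "x + 1" and ?d = "int k + 2 - d"
  have "0 < ?d" "?d < n" using d_mem k_ge by (auto simp: n_def)
  then have "\<not> n dvd ?u + ?d - ?u" by (simp add: zdvd_not_zless)
  then have "?u mod n \<noteq> (?u + ?d) mod n" by (metis mod_eq_dvd_iff)
  moreover have "?u mod n \<in> pverts (circulant_1k k)" "(?u + ?d) mod n \<in> pverts (circulant_1k k)"
    using k_ge by (auto simp: pverts_circulant_1k n_def)
  ultimately show ?thesis
    using that circulant_nbhd_diff_subset_conflict_pair[OF k_ge d_mem, of ?u]
    by (simp add: P_eq n_def)
qed

lemma conflict_pair_subset_circulant_nbhd_diff:
  fixes k :: nat and d u :: int
  defines "n \<equiv> 2 * int k"
  assumes k_ge: "k \<ge> 4" and d_bounds: "0 < d" "d < n"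
  obtains P where "P \<in> conflict_pairs k"
    "P \<subseteq> circulant_nbhd k u - circulant_nbhd k (u + d)"
proof -
  let ?N_u = "circulant_nbhd k u" and ?N_v = "circulant_nbhd k (u + d)"
  have N_u: "?N_u = {(u - 1) mod n, u mod n, (u + 1) mod n, (u + int k) mod n}"
    using circulant_nbhd_eq[of k u] k_ge by (simp add: n_def)
  have mem_N_v: "u mod n \<in> ?N_v \<longleftrightarrow> d \<in> {1, int k, n - 1}"
    "(u + 1) mod n \<in> ?N_v \<longleftrightarrow> d \<in> {1, 2, int k + 1}"
    "(u - 1) mod n \<in> ?N_v \<longleftrightarrow> d \<in> {int k - 1, n - 2, n - 1}"
    "(u + int k) mod n \<in> ?N_v \<longleftrightarrow> d \<in> {int k - 1, int k, int k + 1}"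
    using mem_circulant_nbhd_iff[of k d u] k_ge d_bounds by (simp_all only: n_def)
  have "{1, 2, int k + 1} \<inter> {int k - 1, n - 2, n - 1} = {}" using k_ge by (auto simp: n_def)
  then consider (succ) "d = 1" | (pred) "d = n - 1" | (antipode) "d = int k"
    | (u_and_succ_private) "d \<notin> {1, int k, n - 1}" "d \<notin> {1, 2, int k + 1}"
    | (pred_and_u_private) "d \<notin> {1, int k, n - 1}" "d \<notin> {int k - 1, n - 2, n - 1}"
    by blast
  then obtain x e where "e \<in> {1, 2, int k + 1}" "{x mod n, (x + e) mod n} \<subseteq> ?N_u - ?N_v"
  proof cases
    case succ
    have "(u - 1) mod n \<notin> ?N_v" "(u + int k) mod n \<notin> ?N_v"
      unfolding mem_N_v using succ k_ge by (auto simp: n_def)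
    then show ?thesis by (intro that[of "int k + 1" "u - 1"]) (auto simp: N_u)
  next
    case pred
    have "(u + int k) mod n \<notin> ?N_v" "(u + 1) mod n \<notin> ?N_v"
      unfolding mem_N_v using pred k_ge by (auto simp: n_def)
    moreover have wrap: "(u + int k + (int k + 1)) mod n = (u + 1) mod n"
      using mod_add_self2[of "u + 1" n] by (simp add: n_def algebra_simps)
    ultimately show ?thesis
      by (intro that[of "int k + 1" "u + int k"]) (simp_all only: wrap N_u, auto)
  next
    case antipode
    have "(u - 1) mod n \<notin> ?N_v" "(u + 1) mod n \<notin> ?N_v"
      unfolding mem_N_v using antipode k_ge by (auto simp: n_def)
    then show ?thesis by (intro that[of 2 "u - 1"]) (auto simp: N_u add.commute)
  next
    case u_and_succ_private
    have "u mod n \<notin> ?N_v" "(u + 1) mod n \<notin> ?N_v"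
      unfolding mem_N_v using u_and_succ_private by (auto simp: n_def)
    then show ?thesis by (intro that[of 1 u]) (auto simp: N_u)
  next
    case pred_and_u_private
    have "(u - 1) mod n \<notin> ?N_v" "u mod n \<notin> ?N_v"
      unfolding mem_N_v using pred_and_u_private by (auto simp: n_def)
    then show ?thesis by (intro that[of 1 "u - 1"]) (auto simp: N_u)
  qed
  then show ?thesis using that unfolding conflict_pairs_def n_def by blast
qed

lemma closed_nbhd_diff_contains_conflict_pair:
  assumes k_ge: "k \<ge> 4"
    and u_vertex: "u \<in> pverts (circulant_1k k)"
    and v_vertex: "v \<in> pverts (circulant_1k k)"
    and "u \<noteq> v"
  obtains P where "P \<in> conflict_pairs k"
    "P \<subseteq> closed_nbhd (circulant_1k k) u - closed_nbhd (circulant_1k k) v"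
proof -
  define d where "d = (v - u) mod (2 * int k)"
  have u_mod: "u mod (2 * int k) = u" and "v mod (2 * int k) = v"
    using u_vertex v_vertex by (auto simp: pverts_circulant_1k)
  then have v_eq: "(u + d) mod (2 * int k) = v" by (simp add: d_def mod_simps)
  have "d \<noteq> 0" using u_mod v_eq \<open>u \<noteq> v\<close> by auto
  moreover have "0 \<le> d" "d < 2 * int k" using k_ge by (simp_all add: d_def)
  ultimately have "0 < d" "d < 2 * int k" by simp_all
  then obtain P where "P \<in> conflict_pairs k" "P \<subseteq> circulant_nbhd k u - circulant_nbhd k (u + d)"
    by (rule conflict_pair_subset_circulant_nbhd_diff[OF k_ge])
  then show ?thesis using that by (simp add: u_mod v_eq)
qed

lemma conflict_free_iff_closed_nbhd_diff:
  assumes k_ge: "k \<ge> 4"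
  shows "conflict_free k D \<longleftrightarrow>
    (\<forall>u\<in>pverts (circulant_1k k). \<forall>v\<in>pverts (circulant_1k k). u \<noteq> v \<longrightarrow>
      \<not> closed_nbhd (circulant_1k k) u - closed_nbhd (circulant_1k k) v \<subseteq> D)"
    (is "_ \<longleftrightarrow> ?separated")
proof
  assume "conflict_free k D"
  then show ?separated
    unfolding conflict_free_def
    by (metis closed_nbhd_diff_contains_conflict_pair[OF k_ge] subset_trans)
next
  assume separated: ?separated
  show "conflict_free k D"
    unfolding conflict_free_def
  proof
    fix P
    assume "P \<in> conflict_pairs k"
    with k_ge obtain u v where "u \<in> pverts (circulant_1k k)" "v \<in> pverts (circulant_1k k)" "u \<noteq> v"
      "closed_nbhd (circulant_1k k) u - closed_nbhd (circulant_1k k) v \<subseteq> P"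
      using conflict_pair_contains_closed_nbhd_diff[of k P] by auto
    with separated show "\<not> P \<subseteq> D" by blast
  qed
qed

lemma self_identifying_circulant_1k_iff:
  assumes k_ge: "k \<ge> 4"
  shows "self_identifying (circulant_1k k) C \<longleftrightarrow>
    C \<subseteq> {0..<2 * int k} \<and> conflict_free k ({0..<2 * int k} - C)"
    (is "_ \<longleftrightarrow> C \<subseteq> ?V \<and> _")
proof (cases "C \<subseteq> ?V")
  case True
  let ?N = "closed_nbhd (circulant_1k k)"
  have "?N u \<subseteq> ?V" if "u \<in> ?V" for u
    using k_ge that by (auto simp: closed_nbhd_def circulant_1k_def)
  then have "I_set (circulant_1k k) C u - I_set (circulant_1k k) C v = {} \<longleftrightarrow> ?N u - ?N v \<subseteq> ?V - C"
    if "u \<in> ?V" for u v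
    using that by (auto simp: I_set_def)
  moreover have "C \<noteq> {}" if "conflict_free k (?V - C)"
    using conflict_freeD[OF that, of 0 1] k_ge by auto
  ultimately show ?thesis
    using True conflict_free_iff_closed_nbhd_diff[OF k_ge, of "?V - C"]
    by (auto simp: self_identifying_def is_code_def pverts_circulant_1k)
next
  case False
  then show ?thesis by (simp add: self_identifying_def is_code_def pverts_circulant_1k)
qed

subsection \<open>Maximum conflict-free sets\<close>

definition antipodal_count :: "nat \<Rightarrow> int set \<Rightarrow> nat \<Rightarrow> nat" where
  "antipodal_count k D i =
    of_bool (int i mod (2 * int k) \<in> D) + of_bool ((int i + int k) mod (2 * int k) \<in> D)"

lemma antipodal_count_period: "antipodal_count k D (i + k) = antipodal_count k D i"
proof -
  have "(int i + int k + int k) mod (2 * int k) = int i mod (2 * int k)"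
    using mod_add_self2[of "int i" "2 * int k"] by (simp add: algebra_simps)
  then show ?thesis by (simp add: antipodal_count_def)
qed

lemma sum_antipodal_count:
  assumes "D \<subseteq> {0..<2 * int k}"
  shows "sum (antipodal_count k D) {..<k} = card D"
proof -
  let ?m = "\<lambda>i. of_bool (int i mod (2 * int k) \<in> D) :: nat"
  have "sum (antipodal_count k D) {..<k} = sum ?m {..<k} + (\<Sum>i<k. ?m (i + k))"
    by (simp only: antipodal_count_def[abs_def] sum.distrib of_nat_add)
  also have "\<dots> = sum ?m {0..<k} + sum ?m {k..<k + k}"
    using sum.shift_bounds_nat_ivl[of ?m 0 k k, symmetric] by (simp only: lessThan_atLeast0 add_0)
  also have "\<dots> = sum ?m {0..<2 * k}"
    by (simp only: sum.atLeastLessThan_concat le0 le_add1 mult_2)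
  also have "\<dots> = (\<Sum>i = 0..<2 * k. of_bool (int i \<in> D))" by (intro sum.cong) auto
  also have "\<dots> = (\<Sum>x\<in>int ` {0..<2 * k}. of_bool (x \<in> D))"
    by (simp only: sum.reindex inj_on_of_nat comp_def)
  also have "\<dots> = card ({0..<2 * int k} \<inter> D)" by (simp add: image_int_atLeastLessThan)
  also have "\<dots> = card D" using assms by (simp add: Int_absorb1)
  finally show ?thesis .
qed

lemma conflict_free_antipodal_count_adjacent:
  assumes "conflict_free k D"
  shows "antipodal_count k D i = 0 \<or> antipodal_count k D (i + 1) = 0"
proof -
  let ?n = "2 * int k"
  have wrap: "(int i + int k + (int k + 1)) mod ?n = (int i + 1) mod ?n"
    using mod_add_self2[of "int i + 1" ?n] by (simp add: algebra_simps)
  have "(int i + 1) mod ?n \<notin> D \<and> (int i + (int k + 1)) mod ?n \<notin> D" if "int i mod ?n \<in> D"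
    using conflict_freeD[OF assms that] by blast
  moreover have "(int i + 1) mod ?n \<notin> D \<and> (int i + int k + 1) mod ?n \<notin> D"
    if "(int i + int k) mod ?n \<in> D"
    using conflict_freeD[OF assms that] wrap by (metis insertCI)
  ultimately show ?thesis by (auto simp: antipodal_count_def algebra_simps)
qed

lemma conflict_free_antipodal_count_next_but_one:
  assumes "conflict_free k D"
  shows "antipodal_count k D i + antipodal_count k D (i + 2) \<le> 2"
proof -
  let ?n = "2 * int k"
  have "int i mod ?n \<notin> D \<or> (int i + 2) mod ?n \<notin> D"
    "(int i + int k) mod ?n \<notin> D \<or> (int i + int k + 2) mod ?n \<notin> D"
    using conflict_freeD[OF assms, of _ 2] by blast+
  then show ?thesis by (auto simp: antipodal_count_def algebra_simps)
qed

lemma conflict_free_card_le: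
  assumes "k \<ge> 3" "D \<subseteq> {0..<2 * int k}" "conflict_free k D"
  shows "card D \<le> 2 * (k div 3)"
  using sum_period_le_two_thirds[of k "antipodal_count k D"] assms
    antipodal_count_period conflict_free_antipodal_count_adjacent
    conflict_free_antipodal_count_next_but_one sum_antipodal_count
  by simp

definition block_starts :: "nat \<Rightarrow> int set" where
  "block_starts k = (\<lambda>j. 3 * int j) ` {..<k div 3}"

definition extremal_set :: "nat \<Rightarrow> int set" where
  "extremal_set k = block_starts k \<union> (\<lambda>x. x + int k) ` block_starts k"

lemma block_startsD:
  assumes "x \<in> block_starts k"
  shows "3 dvd x" "0 \<le> x" "x + 3 \<le> int k"
  using assms by (auto simp: block_starts_def)

lemma extremal_set_subset: "extremal_set k \<subseteq> {0..<2 * int k}"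
  by (force simp: extremal_set_def dest: block_startsD)

lemma card_extremal_set: "card (extremal_set k) = 2 * (k div 3)"
proof -
  let ?A = "block_starts k"
  have "card ?A = k div 3" by (simp add: block_starts_def card_image inj_on_def)
  moreover have "card ((\<lambda>x. x + int k) ` ?A) = card ?A" by (simp add: card_image)
  moreover have "?A \<inter> (\<lambda>x. x + int k) ` ?A = {}" by (force dest: block_startsD)
  moreover have "finite ?A" by (simp add: block_starts_def)
  ultimately show ?thesis by (simp add: extremal_set_def card_Un_disjoint)
qed

lemma mod_mem_block_starts:
  assumes "x mod (2 * int k) \<in> extremal_set k"
  shows "x mod int k \<in> block_starts k"
proof -
  have "y mod int k = y" if "y \<in> block_starts k" for y
    using block_startsD[OF that] by (intro mod_pos_pos_trivial) auto
  then have "x mod (2 * int k) mod int k \<in> block_starts k"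
    using assms by (auto simp: extremal_set_def)
  then show ?thesis by (simp add: mod_mod_cancel)
qed

lemma conflict_free_extremal_set: "conflict_free k (extremal_set k)"
proof -
  have "(x + d) mod (2 * int k) \<notin> extremal_set k"
    if x_mem: "x mod (2 * int k) \<in> extremal_set k" and d_mem: "d \<in> {1, 2, int k + 1}" for x d
  proof
    assume sum_mem: "(x + d) mod (2 * int k) \<in> extremal_set k"
    define r where "r = x mod int k"
    have r_block_start: "3 dvd r" "0 \<le> r" "r + 3 \<le> int k"
      using block_startsD[OF mod_mem_block_starts[OF x_mem]] by (auto simp: r_def)
    have "(x + (int k + 1)) mod int k = (x + 1) mod int k"
      using mod_add_self2[of "x + 1" "int k"] by (simp add: algebra_simps)
    then obtain e where e_mem: "e \<in> {1, 2}" and mod_eq: "(x + d) mod int k = (x + e) mod int k"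
      using d_mem by blast
    have "(x + e) mod int k = (r + e) mod int k" by (simp add: r_def mod_simps)
    also have "\<dots> = r + e" using r_block_start e_mem by auto
    finally have "3 dvd r + e"
      using block_startsD(1)[OF mod_mem_block_starts[OF sum_mem]] mod_eq by simp
    then have "3 dvd e" using r_block_start(1) by (simp add: dvd_add_right_iff)
    then show False using e_mem by auto
  qed
  then show ?thesis by (auto simp: conflict_free_def conflict_pairs_def)
qed

lemma gamma_SID_circulant_1k:
  assumes k_ge: "k \<ge> 4"
  shows "gamma_SID (circulant_1k k) = 2 * k - 2 * (k div 3)"
proof -
  let ?V = "{0..<2 * int k}"
  have card_V_diff: "card (?V - A) = 2 * k - card A" if "A \<subseteq> ?V" for A
    using that by (simp add: card_Diff_subset finite_subset)
  have "gamma_SID (circulant_1k k) = card (?V - extremal_set k)"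
  proof (rule gamma_SID_eqI)
    show "finite (pverts (circulant_1k k))" by (simp add: pverts_circulant_1k)
    show "self_identifying (circulant_1k k) (?V - extremal_set k)"
      using conflict_free_extremal_set extremal_set_subset
      by (simp add: self_identifying_circulant_1k_iff[OF k_ge] double_diff)
    fix C
    assume "self_identifying (circulant_1k k) C"
    then have C_code: "C \<subseteq> ?V" "conflict_free k (?V - C)"
      by (simp_all add: self_identifying_circulant_1k_iff[OF k_ge])
    then have "card (?V - C) \<le> card (extremal_set k)"
      using conflict_free_card_le k_ge by (simp add: card_extremal_set)
    then show "card (?V - extremal_set k) \<le> card C"
      using card_V_diff C_code(1) extremal_set_subset by simp
  qed
  then show ?thesis using card_V_diff extremal_set_subset by (simp add: card_extremal_set)
qed

lemma ceiling_four_thirds: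
  "\<lceil>4 * real n / 3\<rceil> = 4 * int (n div 3) + (if n mod 3 = 0 then 0 else int (n mod 3) + 1)"
proof -
  define q r where "q = n div 3" and "r = n mod 3"
  have n_eq: "n = 3 * q + r" by (simp add: q_def r_def)
  have "r < 3" by (simp add: r_def)
  then consider "r = 0" | "r = 1" | "r = 2" by linarith
  then have "\<lceil>4 * real n / 3\<rceil> = 4 * int q + (if r = 0 then 0 else int r + 1)"
    by cases (auto simp: n_eq intro!: ceiling_unique)
  then show ?thesis by (simp only: q_def r_def)
qed

theorem theorem10:
  fixes k :: nat
  assumes "k \<ge> 5"
  shows "int (gamma_SID (circulant_1k k)) =
    (if k mod 3 = 0 \<or> k mod 3 = 1 then \<lceil>4 * real k / 3\<rceil> else \<lceil>4 * real k / 3\<rceil> + 1)"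
proof -
  have "gamma_SID (circulant_1k k) = 2 * k - 2 * (k div 3)"
    using assms by (simp add: gamma_SID_circulant_1k)
  then have gamma_eq: "int (gamma_SID (circulant_1k k)) = 4 * int (k div 3) + 2 * int (k mod 3)"
    using div_mult_mod_eq[of k 3] by linarith
  have "k mod 3 < 3" by simp
  then consider "k mod 3 = 0" | "k mod 3 = 1" | "k mod 3 = 2" by linarith
  then show ?thesis by cases (simp_all add: gamma_eq ceiling_four_thirds)
qed

end
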